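(* Let $(g_n)_{n\in\mathbb{N}}$ be a sequence of functions $g_n\in C_{\mathsf{c}}(\mathbb{R})$ with the following three properties, for all $n\in\mathbb{N}$: $\operatorname{supp}(g_n)\subseteq\bigl[-\frac{1}{n+1},\frac{1}{n+1}\bigr]$, $\|g_n\|_1\geqslant (n^2+1)^n$ and $\|\widehat{g_n}\|_\infty\leqslant 2^{-n}$. Consider the measures $\mu_n$ on $\mathbb{R}$ defined by $$\mu_n(\varphi)=\sum_{j=1}^n\int_{\mathbb{R}}\varphi(x)\,g_j(x+j)\,\mathrm{d}x .$$ Then the sequence $(\mu_n)_{n\in\mathbb{N}}$ converges vaguely to a signed Radon measure $\mu$ that is tempered but not slowly increasing.
   Context: Here $\mathbb{N}=\{1,2,\ldots\}$, $\widehat{g}(t)=\int_{\mathbb{R}}\mathrm{e}^{-2\pi\mathrm{i}tx}g(x)\,\mathrm{d}x$, $\|\cdot\|_1$ is the $L^1$-norm with respect to Lebesgue measure and $\|\cdot\|_\infty$ the sup norm. $C_{\mathsf{c}}(\mathbb{R})$ is the space of continuous functions with compact support, and $C^\infty_{\mathsf{c}}(\mathbb{R})$ the space of smooth functions with compact support. Radon measures are possibly unbounded and in general complex (continuous linear functionals on $C_{\mathsf{c}}(\mathbb{R})$ with its inductive limit topology), and $|\mu|$ is the total variation measure of $\mu$. Measures $\mu_n$ converge vaguely to $\mu$ if $\mu_n(\varphi)\to\mu(\varphi)$ for all $\varphi\in C_{\mathsf{c}}(\mathbb{R})$. A Radon measure $\mu$ on $\mathbb{R}$ is tempered if there is a tempered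 distribution $T\in\mathcal{S}'(\mathbb{R})$ with $\mu(\varphi)=T(\varphi)$ for all $\varphi\in C^\infty_{\mathsf{c}}(\mathbb{R})$; it is slowly increasing if $\int_{\mathbb{R}}\frac{\mathrm{d}|\mu|(x)}{1+|P(x)|}<\infty$ for some polynomial $P\in\mathbb{C}[x]$. *)

theory Defs
  imports "HOL-Analysis.Analysis" "HOL-Computational_Algebra.Polynomial"
begin

definition supp :: "(real \<Rightarrow> 'a::real_normed_vector) \<Rightarrow> real set" where
  "supp f = closure (support_on UNIV f)"

definition Cc :: "(real \<Rightarrow> 'a::real_normed_vector) set" where
  "Cc = {f. continuous_on UNIV f \<and> compact (supp f)}"

definition iter_deriv :: "nat \<Rightarrow> (real \<Rightarrow> complex) \<Rightarrow> real \<Rightarrow> complex" where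
  "iter_deriv m = (\<lambda>f x. vector_derivative f (at x)) ^^ m"

definition smooth :: "(real \<Rightarrow> complex) \<Rightarrow> bool" where
  "smooth f \<longleftrightarrow> (\<forall>m x. iter_deriv m f differentiable (at x))"

definition Cc_infinity :: "(real \<Rightarrow> complex) set" where
  "Cc_infinity = {f. smooth f \<and> compact (supp f)}"

definition L1_norm :: "(real \<Rightarrow> complex) \<Rightarrow> real" where
  "L1_norm f = (LBINT x. cmod (f x))"

text \<open>The real supremum carries no information for an unbounded set;
  \<open>sup_norm\<close> is only meant to be applied to bounded functions.\<close>

definition sup_norm :: "(real \<Rightarrow> complex) \<Rightarrow> real" where
  "sup_norm f = (SUP x. cmod (f x))"

definition fourier :: "(real \<Rightarrow> complex) \<Rightarrow> real \<Rightarrow> complex" where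
  "fourier f t = (LBINT x. exp (- (2 * of_real pi * \<i> * of_real t * of_real x)) * f x)"

text \<open>Functionals on a space \<open>V\<close> of test functions are total functions whose values
  outside \<open>V\<close> are irrelevant.\<close>

definition complex_linear_on ::
    "(real \<Rightarrow> complex) set \<Rightarrow> ((real \<Rightarrow> complex) \<Rightarrow> complex) \<Rightarrow> bool" where
  "complex_linear_on V L \<longleftrightarrow>
     (\<forall>\<phi>\<in>V. \<forall>\<psi>\<in>V. L (\<lambda>x. \<phi> x + \<psi> x) = L \<phi> + L \<psi>) \<and>
     (\<forall>c. \<forall>\<phi>\<in>V. L (\<lambda>x. c * \<phi> x) = c * L \<phi>)"

text \<open>A linear functional is continuous for the inductive limit topology of \<open>Cc\<close> iff, for each
  compact \<open>K\<close>, its restriction to the functions supported in \<open>K\<close> is continuous, that is,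
  bounded, for the supremum norm.\<close>

definition radon_measure :: "((real \<Rightarrow> complex) \<Rightarrow> complex) \<Rightarrow> bool" where
  "radon_measure \<mu> \<longleftrightarrow> complex_linear_on Cc \<mu> \<and>
     (\<forall>K. compact K \<longrightarrow>
        (\<exists>C. \<forall>\<phi>\<in>Cc. supp \<phi> \<subseteq> K \<longrightarrow> cmod (\<mu> \<phi>) \<le> C * sup_norm \<phi>))"

definition signed_radon_measure :: "((real \<Rightarrow> complex) \<Rightarrow> complex) \<Rightarrow> bool" where
  "signed_radon_measure \<mu> \<longleftrightarrow> radon_measure \<mu> \<and>
     (\<forall>\<phi>\<in>Cc. (\<forall>x. \<phi> x \<in> \<real>) \<longrightarrow> \<mu> \<phi> \<in> \<real>)"

definition converges_vaguely ::
    "(nat \<Rightarrow> (real \<Rightarrow> complex) \<Rightarrow> complex) \<Rightarrow> ((real \<Rightarrow> complex) \<Rightarrow> complex) \<Rightarrow> bool" where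
  "converges_vaguely M \<mu> \<longleftrightarrow> (\<forall>\<phi>\<in>Cc. (\<lambda>n. M n \<phi>) \<longlonglongrightarrow> \<mu> \<phi>)"

definition schwartz_seminorm :: "nat \<Rightarrow> nat \<Rightarrow> (real \<Rightarrow> complex) \<Rightarrow> real" where
  "schwartz_seminorm k m f = (SUP x. \<bar>x\<bar> ^ k * cmod (iter_deriv m f x))"

definition schwartz_space :: "(real \<Rightarrow> complex) set" where
  "schwartz_space = {f. smooth f \<and>
     (\<forall>k m. bdd_above (range (\<lambda>x. \<bar>x\<bar> ^ k * cmod (iter_deriv m f x))))}"

text \<open>Continuity for the topology defined by the Schwartz seminorms: the functional is bounded by
  a multiple of a sum of finitely many of them.\<close>

definition tempered_distribution :: "((real \<Rightarrow> complex) \<Rightarrow> complex) \<Rightarrow> bool" where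
  "tempered_distribution T \<longleftrightarrow> complex_linear_on schwartz_space T \<and>
     (\<exists>C N. \<forall>\<phi>\<in>schwartz_space.
        cmod (T \<phi>) \<le> C * (\<Sum>k\<le>N. \<Sum>m\<le>N. schwartz_seminorm k m \<phi>))"

definition tempered :: "((real \<Rightarrow> complex) \<Rightarrow> complex) \<Rightarrow> bool" where
  "tempered \<mu> \<longleftrightarrow> (\<exists>T. tempered_distribution T \<and> (\<forall>\<phi>\<in>Cc_infinity. \<mu> \<phi> = T \<phi>))"

text \<open>The total variation of \<open>\<mu>\<close> is the positive functional sending a nonnegative \<open>\<phi>\<close> in \<open>Cc\<close>
  to the supremum of the \<open>\<bar>\<mu>(\<psi>)\<bar>\<close> with \<open>\<bar>\<psi>\<bar> \<le> \<phi>\<close>; as a measure, it is the Borel measure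
  representing this functional, which by the Riesz representation theorem exists and is unique
  for every Radon measure \<open>\<mu>\<close>.\<close>

definition is_total_variation :: "((real \<Rightarrow> complex) \<Rightarrow> complex) \<Rightarrow> real measure \<Rightarrow> bool" where
  "is_total_variation \<mu> \<nu> \<longleftrightarrow> sets \<nu> = sets borel \<and>
     (\<forall>\<phi>::real \<Rightarrow> real. \<phi> \<in> Cc \<longrightarrow> (\<forall>x. 0 \<le> \<phi> x) \<longrightarrow>
        (\<integral>\<^sup>+x. ennreal (\<phi> x) \<partial>\<nu>) =
        (SUP \<psi>\<in>{\<psi>\<in>Cc. \<forall>x. cmod (\<psi> x) \<le> \<phi> x}. ennreal (cmod (\<mu> \<psi>))))"

definition total_variation :: "((real \<Rightarrow> complex) \<Rightarrow> complex) \<Rightarrow> real measure" where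
  "total_variation \<mu> = (THE \<nu>. is_total_variation \<mu> \<nu>)"

definition slowly_increasing :: "((real \<Rightarrow> complex) \<Rightarrow> complex) \<Rightarrow> bool" where
  "slowly_increasing \<mu> \<longleftrightarrow> (\<exists>P :: complex poly.
     (\<integral>\<^sup>+x. ennreal (1 / (1 + cmod (poly P (of_real x)))) \<partial>total_variation \<mu>) < \<infinity>)"

end

theory Submission
  imports Defs "HOL-Probability.Characteristic_Functions" "HOL-Probability.Sinc_Integral"
begin

text \<open>
  The summands \<open>h\<^sub>n = g\<^sub>n(\<cdot> + n)\<close> live on disjoint intervals around \<open>-n\<close>, so they add up
  to a continuous function \<open>G\<close>, and on test functions of compact support the series of measures
  is eventually constant, with limit the measure of density \<open>G\<close>. This settles vague
  convergence, the Radon property and realness.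

  The measure is tempered because of cancellation inside each \<open>h\<^sub>n\<close>. For a Schwartz function
  \<open>f\<close>, Fourier inversion and Fubini turn \<open>\<integral> f h\<^sub>n\<close> into an integral of the product of the two
  Fourier transforms, so it is at most
  \<open>\<parallel>f^\<parallel>\<^sub>1 \<parallel>h\<^sub>n^\<parallel>\<^sub>\<infinity> \<le> 2\<^sup>-\<^sup>n \<parallel>f^\<parallel>\<^sub>1\<close> (\<open>cmod_integral_mult_le\<close>; a translation
  changes a Fourier transform by a phase only). The series therefore converges on the whole Schwartz
  space. Integrating by parts twice bounds \<open>\<parallel>f^\<parallel>\<^sub>1\<close> by the integrals of \<open>f\<close> and of its
  second derivative, hence by finitely many Schwartz seminorms (\<open>schwartz_fourier_L1\<close>).

  The total variation, on the other hand, does not see this cancellation: it is the measure of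
  density \<open>\<bar>G\<bar>\<close> (\<open>total_variation_density\<close>), and it gives the interval around \<open>-n\<close> the
  mass \<open>\<parallel>g\<^sub>n\<parallel>\<^sub>1 \<ge> (n\<^sup>2 + 1)\<^sup>n\<close>. A polynomial of degree \<open>d\<close> is only of size
  \<open>O((n\<^sup>2 + 1)\<^sup>d)\<close> there, so no polynomial weight makes the total mass finite
  (\<open>not_slowly_increasing_density\<close>).
\<close>

section \<open>Continuous functions of compact support\<close>

lemma zero_outside_supp: "x \<notin> supp f \<Longrightarrow> f x = 0"
  unfolding supp_def support_on_def using subsetD[OF closure_subset, of x "{x. f x \<noteq> 0}"]
  by auto

text \<open>On the line, compact support can be read off pointwise from vanishing far out, which avoids
  handling the closure in \<open>supp\<close>.\<close>

lemma Cc_iff: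
  fixes f :: "real \<Rightarrow> 'a::real_normed_vector"
  shows "f \<in> Cc \<longleftrightarrow> continuous_on UNIV f \<and> (\<exists>R. \<forall>x. R < \<bar>x\<bar> \<longrightarrow> f x = 0)"
proof
  assume f: "f \<in> Cc"
  then have "bounded (supp f)" by (auto simp: Cc_def intro: compact_imp_bounded)
  then obtain R where R: "\<And>x. x \<in> supp f \<Longrightarrow> norm x \<le> R"
    unfolding bounded_iff by blast
  have "f x = 0" if "R < \<bar>x\<bar>" for x
    using R[of x] that by (intro zero_outside_supp) auto
  with f show "continuous_on UNIV f \<and> (\<exists>R. \<forall>x. R < \<bar>x\<bar> \<longrightarrow> f x = 0)"
    by (auto simp: Cc_def)
next
  assume "continuous_on UNIV f \<and> (\<exists>R. \<forall>x. R < \<bar>x\<bar> \<longrightarrow> f x = 0)"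
  then obtain R where f: "continuous_on UNIV f" and R: "\<And>x. R < \<bar>x\<bar> \<Longrightarrow> f x = 0" by auto
  have "support_on UNIV f \<subseteq> {-R..R}"
    using R by (force simp: support_on_def)
  then have "supp f \<subseteq> {-R..R}"
    unfolding supp_def by (rule closure_minimal) simp
  then have "bounded (supp f)" by (rule bounded_subset[rotated]) simp
  then have "compact (supp f)"
    by (simp add: compact_eq_bounded_closed supp_def)
  with f show "f \<in> Cc" by (simp add: Cc_def)
qed

lemma Cc_continuous: "f \<in> Cc \<Longrightarrow> continuous_on UNIV f"
  by (simp add: Cc_def)

lemma Cc_add: "f \<in> Cc \<Longrightarrow> h \<in> Cc \<Longrightarrow> (\<lambda>x. f x + h x) \<in> Cc"
  unfolding Cc_iff
proof (elim conjE exE, intro conjI)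
  fix R S
  assume *: "\<forall>x. R < \<bar>x\<bar> \<longrightarrow> f x = 0" "\<forall>x. S < \<bar>x\<bar> \<longrightarrow> h x = 0"
  then show "\<exists>R. \<forall>x. R < \<bar>x\<bar> \<longrightarrow> f x + h x = 0"
    by (intro exI[of _ "max R S"]) auto
qed (intro continuous_intros)

lemma Cc_transform:
  assumes "f \<in> Cc" "continuous_on UNIV h" "\<And>x. f x = 0 \<Longrightarrow> h x = 0"
  shows "h \<in> Cc"
  using assms unfolding Cc_iff by blast

lemma Cc_mult_continuous:
  fixes f h :: "real \<Rightarrow> 'a::real_normed_algebra"
  assumes "f \<in> Cc" "continuous_on UNIV h"
  shows "(\<lambda>x. f x * h x) \<in> Cc"
  by (rule Cc_transform[OF assms(1)]) (simp_all add: continuous_on_mult[OF Cc_continuous] assms)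

lemma Cc_of_real: "f \<in> Cc \<Longrightarrow> (\<lambda>x. complex_of_real (f x)) \<in> Cc"
  by (rule Cc_transform, assumption) (auto intro!: continuous_on_of_real Cc_continuous)

lemma integrable_Cc:
  fixes f :: "real \<Rightarrow> 'a::{banach, second_countable_topology}"
  assumes "f \<in> Cc"
  shows "integrable lborel f"
proof -
  obtain R where f: "continuous_on UNIV f" and R: "\<And>x. R < \<bar>x\<bar> \<Longrightarrow> f x = 0"
    using assms by (auto simp: Cc_iff)
  have "set_integrable lborel {-R..R} f"
    by (rule borel_integrable_atLeastAtMost') (rule continuous_on_subset[OF f], simp)
  moreover have "(\<lambda>x. indicator {-R..R} x *\<^sub>R f x) = f"
    using R by (force simp: indicator_def)
  ultimately show ?thesis by (simp add: set_integrable_def)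
qed

lemma Cc_bdd_above:
  fixes f :: "real \<Rightarrow> complex"
  assumes "f \<in> Cc"
  shows "bdd_above (range (\<lambda>x. cmod (f x)))"
proof -
  obtain R where f: "continuous_on UNIV f" and R: "\<And>x. R < \<bar>x\<bar> \<Longrightarrow> f x = 0"
    using assms by (auto simp: Cc_iff)
  have "bounded (f ` {-R..R})"
    by (intro compact_imp_bounded compact_continuous_image continuous_on_subset[OF f]) auto
  then obtain B where B: "\<And>x. x \<in> {-R..R} \<Longrightarrow> cmod (f x) \<le> B"
    unfolding bounded_iff by blast
  have "cmod (f x) \<le> max B 0" for x
  proof (cases "R < \<bar>x\<bar>")
    case False
    then have "x \<in> {-R..R}" by auto
    then show ?thesis using B by (simp add: le_max_iff_disj)
  qed (simp add: R)
  then show ?thesis by (auto simp: bdd_above_def)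
qed

lemma Cc_le_sup_norm: "f \<in> Cc \<Longrightarrow> cmod (f x) \<le> sup_norm f"
  unfolding sup_norm_def by (rule cSUP_upper) (auto intro: Cc_bdd_above)

section \<open>Measures with a continuous density and their total variation\<close>

lemma radon_measure_density:
  assumes G: "continuous_on UNIV G"
    and \<mu>: "\<And>\<phi>. \<phi> \<in> Cc \<Longrightarrow> \<mu> \<phi> = (LBINT x. \<phi> x * G x)"
  shows "radon_measure \<mu>"
  unfolding radon_measure_def
proof (intro conjI allI impI)
  have int: "integrable lborel (\<lambda>x. \<phi> x * G x)" if "\<phi> \<in> Cc" for \<phi>
    by (intro integrable_Cc Cc_mult_continuous that G)
  have const: "(\<lambda>x. c * \<phi> x) \<in> Cc" if "\<phi> \<in> Cc" for \<phi> :: "real \<Rightarrow> complex" and c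
    by (rule Cc_transform[OF that]) (simp_all add: continuous_on_mult_left Cc_continuous that)
  show "complex_linear_on Cc \<mu>"
    unfolding complex_linear_on_def
    by (auto simp: \<mu> Cc_add const int distrib_right mult.assoc)
  fix K :: "real set"
  assume "compact K"
  then have "bounded K" by (rule compact_imp_bounded)
  then obtain R where R: "\<And>x. x \<in> K \<Longrightarrow> \<bar>x\<bar> \<le> R"
    unfolding bounded_iff real_norm_def by blast
  have I: "set_integrable lborel {-R..R} (\<lambda>x. cmod (G x))"
    by (intro borel_integrable_atLeastAtMost' continuous_intros continuous_on_subset[OF G]) simp
  show "\<exists>C. \<forall>\<phi>\<in>Cc. supp \<phi> \<subseteq> K \<longrightarrow> cmod (\<mu> \<phi>) \<le> C * sup_norm \<phi>"
  proof (intro exI ballI impI)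
    fix \<phi> :: "real \<Rightarrow> complex" assume \<phi>: "\<phi> \<in> Cc" and K: "supp \<phi> \<subseteq> K"
    have le: "norm (\<phi> x * G x) \<le> sup_norm \<phi> * (indicator {-R..R} x * cmod (G x))" for x
    proof (cases "x \<in> {-R..R}")
      case True
      then show ?thesis using Cc_le_sup_norm[OF \<phi>] by (simp add: norm_mult mult_right_mono)
    next
      case False
      then have "x \<notin> supp \<phi>" using R K by fastforce
      then show ?thesis using False by (simp add: zero_outside_supp)
    qed
    have "cmod (\<mu> \<phi>) \<le> (LBINT x. norm (\<phi> x * G x))"
      unfolding \<mu>[OF \<phi>] by (rule integral_norm_bound)
    also have "\<dots> \<le> (LBINT x. sup_norm \<phi> * (indicator {-R..R} x * cmod (G x)))"
      using le I by (intro integral_mono integrable_norm int \<phi>) (auto simp: set_integrable_def)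
    finally show "cmod (\<mu> \<phi>) \<le> (LBINT x. indicator {-R..R} x * cmod (G x)) * sup_norm \<phi>"
      by (simp add: mult.commute)
  qed
qed

text \<open>The supremum would be attained at \<open>\<psi> = \<phi> \<cdot> cnj G / \<bar>G\<bar>\<close>, which need not be
  continuous at the zeros of \<open>G\<close>. Replacing the denominator by \<open>\<bar>G\<bar> + d\<close> gives an admissible
  \<open>\<psi>\<close>, and \<open>\<bar>G\<bar>\<^sup>2 / (\<bar>G\<bar> + d) \<ge> \<bar>G\<bar> - d\<close> shows that it misses the integral of
  \<open>\<phi> \<bar>G\<bar>\<close> by at most \<open>d \<integral> \<phi>\<close>.\<close>

lemma is_total_variation_density:
  assumes G: "continuous_on UNIV G"
    and \<mu>: "\<And>\<phi>. \<phi> \<in> Cc \<Longrightarrow> \<mu> \<phi> = (LBINT x. \<phi> x * G x)"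
  shows "is_total_variation \<mu> (density lborel (\<lambda>x. ennreal (cmod (G x))))"
  unfolding is_total_variation_def
proof (intro conjI allI impI)
  show "sets (density lborel (\<lambda>x. ennreal (cmod (G x)))) = sets borel" by simp
  fix \<phi> :: "real \<Rightarrow> real" assume \<phi>: "\<phi> \<in> Cc" and pos: "\<forall>x. 0 \<le> \<phi> x"
  have [measurable]: "G \<in> borel_measurable borel" "\<phi> \<in> borel_measurable borel"
    using G Cc_continuous[OF \<phi>] by (auto intro: borel_measurable_continuous_onI)
  have int\<phi>: "integrable lborel \<phi>" by (rule integrable_Cc[OF \<phi>])
  have int: "integrable lborel (\<lambda>x. \<phi> x * cmod (G x))"
    by (intro integrable_Cc Cc_mult_continuous \<phi> continuous_intros G)
  let ?I = "LBINT x. \<phi> x * cmod (G x)"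
  let ?S = "SUP \<psi>\<in>{\<psi>\<in>Cc. \<forall>x. cmod (\<psi> x) \<le> \<phi> x}. ennreal (cmod (\<mu> \<psi>))"
  have eq: "(\<integral>\<^sup>+x. ennreal (\<phi> x) \<partial>density lborel (\<lambda>x. ennreal (cmod (G x)))) = ennreal ?I"
    using pos by (simp add: nn_integral_density nn_integral_eq_integral[OF int, symmetric]
        ennreal_mult' mult.commute)
  show "(\<integral>\<^sup>+x. ennreal (\<phi> x) \<partial>density lborel (\<lambda>x. ennreal (cmod (G x)))) = ?S"
    unfolding eq
  proof (rule antisym)
    show "?S \<le> ennreal ?I"
    proof (rule SUP_least, clarify)
      fix \<psi> :: "real \<Rightarrow> complex" assume \<psi>: "\<psi> \<in> Cc" and le: "\<forall>x. cmod (\<psi> x) \<le> \<phi> x"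
      have "cmod (\<mu> \<psi>) \<le> (LBINT x. norm (\<psi> x * G x))"
        unfolding \<mu>[OF \<psi>] by (rule integral_norm_bound)
      also have "\<dots> \<le> ?I"
        using le by (intro integral_mono int integrable_norm integrable_Cc Cc_mult_continuous \<psi> G)
          (auto simp: norm_mult mult_right_mono)
      finally show "ennreal (cmod (\<mu> \<psi>)) \<le> ennreal ?I" by (rule ennreal_leI)
    qed
    show "ennreal ?I \<le> ?S"
    proof (rule ennreal_le_epsilon)
      fix e :: real assume e: "0 < e"
      \<comment> \<open>the summand 1 keeps the quotient meaningful when the integral of \<open>\<phi>\<close> is 0\<close>
      define d where "d = e / (1 + (LBINT x. \<phi> x))"
      have \<phi>0: "0 \<le> (LBINT x. \<phi> x)" using pos by (simp add: integral_nonneg_AE)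
      then have d: "0 < d" using e by (simp add: d_def)
      have de: "d * (LBINT x. \<phi> x) \<le> e"
        using e \<phi>0 by (simp add: d_def field_simps)
      define \<psi> where "\<psi> x = complex_of_real (\<phi> x) * (cnj (G x) / complex_of_real (cmod (G x) + d))" for x
      have nz: "complex_of_real (cmod (G x) + d) \<noteq> 0" for x
        using d by (metis add_nonneg_pos less_irrefl norm_ge_zero of_real_eq_0_iff)
      have \<psi>: "\<psi> \<in> Cc"
        unfolding \<psi>_def using nz
        by (intro Cc_mult_continuous Cc_of_real \<phi> continuous_intros G) auto
      have \<psi>G: "\<psi> x * G x = complex_of_real (\<phi> x * ((cmod (G x))\<^sup>2 / (cmod (G x) + d)))" for x
        unfolding \<psi>_def
        by (simp add: mult.commute[of "cnj _"] complex_norm_square[symmetric] del: of_real_add)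
      have le: "cmod (\<psi> x) \<le> \<phi> x" for x
      proof -
        have "cmod (\<psi> x) = \<phi> x * (cmod (G x) / (cmod (G x) + d))"
          using pos d unfolding \<psi>_def by (simp add: norm_mult norm_divide del: of_real_add)
        also have "\<dots> \<le> \<phi> x * 1"
          using pos d by (intro mult_left_mono) (auto simp: divide_simps add_nonneg_pos)
        finally show ?thesis by simp
      qed
      have int2: "integrable lborel (\<lambda>x. \<phi> x * ((cmod (G x))\<^sup>2 / (cmod (G x) + d)))"
        using nz
        by (intro integrable_Cc Cc_mult_continuous \<phi> continuous_intros G) (metis of_real_0)
      have low: "\<phi> x * cmod (G x) - d * \<phi> x \<le> \<phi> x * ((cmod (G x))\<^sup>2 / (cmod (G x) + d))" for x
      proof -
        have "(cmod (G x) - d) * (cmod (G x) + d) \<le> (cmod (G x))\<^sup>2"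
          by (simp add: power2_eq_square algebra_simps)
        then have "cmod (G x) - d \<le> (cmod (G x))\<^sup>2 / (cmod (G x) + d)"
          by (subst pos_le_divide_eq[OF add_nonneg_pos[OF norm_ge_zero d]])
        from mult_left_mono[OF this, of "\<phi> x"] pos show ?thesis by (simp add: algebra_simps)
      qed
      have "?I - e \<le> ?I - d * (LBINT x. \<phi> x)" using de by simp
      also have "\<dots> = (LBINT x. \<phi> x * cmod (G x) - d * \<phi> x)"
        using int int\<phi> by simp
      also have "\<dots> \<le> (LBINT x. \<phi> x * ((cmod (G x))\<^sup>2 / (cmod (G x) + d)))"
        by (intro integral_mono int2 low Bochner_Integration.integrable_diff int integrable_mult_right int\<phi>)
      also have "\<dots> \<le> cmod (\<mu> \<psi>)"
        unfolding \<mu>[OF \<psi>] \<psi>G integral_complex_of_real by simp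
      finally have "?I \<le> cmod (\<mu> \<psi>) + e" by simp
      then have "ennreal ?I \<le> ennreal (cmod (\<mu> \<psi>)) + ennreal e"
        using e by (metis ennreal_leI ennreal_plus less_imp_le norm_ge_zero)
      also have "\<dots> \<le> ?S + ennreal e"
        using \<psi> le by (intro add_right_mono SUP_upper) auto
      finally show "ennreal ?I \<le> ?S + ennreal e" .
    qed
  qed
qed

text \<open>Open intervals generate the Borel sets, and the indicator of an open interval is the increasing
  limit of the piecewise linear functions \<open>\<phi> k\<close> below, to which monotone convergence applies.\<close>

lemma measure_eqI_Cc:
  fixes M N :: "real measure"
  assumes sets: "sets M = sets borel" "sets N = sets borel"
    and eq: "\<And>\<phi>::real \<Rightarrow> real. \<phi> \<in> Cc \<Longrightarrow> (\<And>x. 0 \<le> \<phi> x) \<Longrightarrow>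
       (\<integral>\<^sup>+x. ennreal (\<phi> x) \<partial>M) = (\<integral>\<^sup>+x. ennreal (\<phi> x) \<partial>N)"
    and fin: "\<And>a b. emeasure M {a<..<b} < \<infinity>"
  shows "M = N"
proof (rule measure_eqI_generator_eq)
  let ?E = "range (\<lambda>(a, b). {a<..<b :: real})"
  show "Int_stable ?E"
  proof (rule Int_stableI, clarify)
    fix a b c d :: real
    have "{a<..<b} \<inter> {c<..<d} = {max a c<..<min b d}" by auto
    then show "{a<..<b} \<inter> {c<..<d} \<in> ?E" by auto
  qed
  show "?E \<subseteq> Pow UNIV" by simp
  have "sets borel = sigma_sets UNIV (range (\<lambda>(a, b). box a b :: real set))"
    by (subst borel_eq_box) simp
  also have "range (\<lambda>(a, b). box a b :: real set) = ?E"
    by (rule arg_cong[where f = range]) auto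
  finally show "sets M = sigma_sets UNIV ?E" "sets N = sigma_sets UNIV ?E"
    by (simp_all add: sets)
  show "range (\<lambda>n. {- real n<..<real n}) \<subseteq> ?E" by auto
  show "(\<Union>n. {- real n<..<real n}) = UNIV"
  proof safe
    fix x :: real
    obtain n where "\<bar>x\<bar> < real n" using reals_Archimedean2 by blast
    then show "x \<in> (\<Union>n. {- real n<..<real n})" by (auto intro!: exI[of _ n])
  qed simp
  show "emeasure M {- real n<..<real n} \<noteq> \<infinity>" for n
    using fin[of "- real n" "real n"] by simp
  fix X assume "X \<in> ?E"
  then obtain a b where X: "X = {a<..<b}" by auto
  define \<phi> where "\<phi> k x = min 1 (real k * max 0 (min (x - a) (b - x)))" for k x
  have \<phi>: "\<phi> k \<in> Cc" for k
    unfolding Cc_iff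
  proof (intro conjI exI allI impI)
    show "continuous_on UNIV (\<phi> k)" unfolding \<phi>_def by (intro continuous_intros)
    fix x assume "max \<bar>a\<bar> \<bar>b\<bar> < \<bar>x\<bar>"
    then have "min (x - a) (b - x) \<le> 0" by linarith
    then show "\<phi> k x = 0" by (simp add: \<phi>_def max_absorb1)
  qed
  have \<phi>0: "0 \<le> \<phi> k x" for k x by (simp add: \<phi>_def)
  have [measurable]: "\<phi> k \<in> borel_measurable borel" for k
    using Cc_continuous[OF \<phi>] by (rule borel_measurable_continuous_onI)
  have lim: "indicator X x = (SUP k. ennreal (\<phi> k x))" for x
  proof (rule antisym)
    show "(SUP k. ennreal (\<phi> k x)) \<le> indicator X x"
      by (rule SUP_least) (auto simp: X \<phi>_def indicator_def min_def max_def)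
    show "indicator X x \<le> (SUP k. ennreal (\<phi> k x))"
    proof (cases "x \<in> X")
      case True
      define r where "r = min (x - a) (b - x)"
      have r: "0 < r" using True by (simp add: X r_def)
      then obtain k where "1 / r < real k" using reals_Archimedean2 by blast
      then have "1 \<le> real k * max 0 r" using r by (simp add: field_simps)
      then have "\<phi> k x = 1" by (simp add: \<phi>_def r_def)
      then show ?thesis using SUP_upper[of k UNIV "\<lambda>k. ennreal (\<phi> k x)"] True by simp
    qed simp
  qed
  have inc: "incseq (\<lambda>k x. ennreal (\<phi> k x))"
    unfolding \<phi>_def by (intro monoI le_funI ennreal_leI min.mono mult_right_mono) auto
  have *: "emeasure L X = (SUP k. \<integral>\<^sup>+x. ennreal (\<phi> k x) \<partial>L)" if L: "sets L = sets borel" for L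
  proof -
    have [measurable]: "\<phi> k \<in> borel_measurable L" for k
      by (simp add: measurable_cong_sets[OF L refl])
    have "emeasure L X = (\<integral>\<^sup>+x. indicator X x \<partial>L)" by (simp add: X L)
    also have "\<dots> = (SUP k. \<integral>\<^sup>+x. ennreal (\<phi> k x) \<partial>L)"
      unfolding lim by (intro nn_integral_monotone_convergence_SUP inc) simp
    finally show ?thesis .
  qed
  show "emeasure M X = emeasure N X"
    unfolding *[OF sets(1)] *[OF sets(2)] using eq[OF \<phi> \<phi>0] by simp
qed

text \<open>Since \<open>total_variation\<close> is a definite description, uniqueness is needed besides
  \<open>is_total_variation_density\<close>; it follows from \<open>measure_eqI_Cc\<close>, as a continuous density has
  finite mass on bounded intervals.\<close>

lemma total_variation_density:
  assumes G: "continuous_on UNIV G"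
    and \<mu>: "\<And>\<phi>. \<phi> \<in> Cc \<Longrightarrow> \<mu> \<phi> = (LBINT x. \<phi> x * G x)"
  shows "total_variation \<mu> = density lborel (\<lambda>x. ennreal (cmod (G x)))"
  unfolding total_variation_def
proof (rule the_equality)
  let ?D = "density lborel (\<lambda>x. ennreal (cmod (G x)))"
  have [measurable]: "G \<in> borel_measurable borel"
    using G by (auto intro: borel_measurable_continuous_onI)
  show D: "is_total_variation \<mu> ?D"
    by (rule is_total_variation_density[OF G \<mu>])
  fix \<nu> assume \<nu>: "is_total_variation \<mu> \<nu>"
  have fin: "emeasure ?D {a<..<b} < \<infinity>" for a b
  proof -
    have I: "integrable lborel (\<lambda>x. indicator {a..b} x * cmod (G x))"
      using borel_integrable_atLeastAtMost'[of a b "\<lambda>x. cmod (G x)"] G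
      by (auto simp: set_integrable_def intro!: continuous_intros intro: continuous_on_subset)
    have "emeasure ?D {a<..<b} \<le> emeasure ?D {a..b}"
      by (intro emeasure_mono) auto
    also have "\<dots> = ennreal (LBINT x. indicator {a..b} x * cmod (G x))"
      by (subst nn_integral_eq_integral[OF I, symmetric])
        (auto simp: emeasure_density indicator_def intro!: nn_integral_cong)
    also have "\<dots> < \<infinity>" by simp
    finally show ?thesis .
  qed
  show "\<nu> = ?D"
    by (rule measure_eqI_Cc[OF _ _ _ fin, symmetric])
      (use \<nu> D in \<open>simp_all add: is_total_variation_def\<close>)
qed

section \<open>Fourier inversion\<close>

text \<open>A form of the definition that matches the kernel \<open>iexp\<close> of characteristic functions.\<close>

lemma fourier_iexp: "fourier f t = (LBINT x. iexp (- (2 * pi * t * x)) * f x)"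
  unfolding fourier_def by (simp add: algebra_simps)

lemma cmod_fourier_le: "cmod (fourier f t) \<le> (LBINT x. cmod (f x))"
proof -
  have "cmod (fourier f t) \<le> (LBINT x. cmod (iexp (- (2 * pi * t * x)) * f x))"
    unfolding fourier_iexp by (rule integral_norm_bound)
  then show ?thesis by (simp add: norm_mult)
qed

lemma cmod_fourier_shift: "cmod (fourier (\<lambda>x. f (x + a)) t) = cmod (fourier f t)"
proof -
  have "fourier f t = (LBINT x. iexp (- (2 * pi * t * (a + 1 * x))) * f (a + 1 * x))"
    unfolding fourier_iexp
    by (subst lborel_integral_real_affine[where c = 1 and t = a]) auto
  also have "\<dots> = (LBINT x. iexp (- (2 * pi * t * a)) * (iexp (- (2 * pi * t * x)) * f (x + a)))"
    by (intro Bochner_Integration.integral_cong refl)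
      (simp add: algebra_simps flip: exp_add)
  also have "\<dots> = iexp (- (2 * pi * t * a)) * fourier (\<lambda>x. f (x + a)) t"
    unfolding fourier_iexp by simp
  finally show ?thesis by (simp add: norm_mult)
qed

lemma borel_measurable_fourier [measurable]:
  assumes [measurable]: "f \<in> borel_measurable borel"
  shows "fourier f \<in> borel_measurable borel"
  unfolding fourier_iexp[abs_def] by measurable

text \<open>A rescaled form of the characteristic function of the standard normal distribution: the
  Gaussian is its own Fourier transform. It supplies the convergence factor in the proof of Fourier
  inversion.\<close>

lemma integral_iexp_gaussian:
  fixes e z :: real
  assumes e: "0 < e"
  shows "integrable lborel (\<lambda>t. exp (- (e * t)\<^sup>2 / 2))"
    and "(LBINT t. iexp (- (2 * pi * t * z)) * exp (- (e * t)\<^sup>2 / 2))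
       = complex_of_real (sqrt (2 * pi) / e * exp (- (2 * pi * z / e)\<^sup>2 / 2))"
proof -
  have n: "exp (- t\<^sup>2 / 2) = sqrt (2 * pi) * std_normal_density t" for t
    by (simp add: std_normal_density_def)
  have "integrable lborel (\<lambda>t. sqrt (2 * pi) * std_normal_density (0 + e * t))"
    using e by (intro integrable_mult_right lborel_integrable_real_affine) auto
  then show "integrable lborel (\<lambda>t. exp (- (e * t)\<^sup>2 / 2))"
    unfolding n by simp
  have "char std_normal_distribution (- (2 * pi * z / e))
      = (LBINT s. std_normal_density s *\<^sub>R iexp (- (2 * pi * z / e) * s))"
    unfolding char_def by (subst integral_density) auto
  also have "\<dots> = e *\<^sub>R (LBINT t. std_normal_density (0 + e * t) *\<^sub>R iexp (- (2 * pi * z / e) * (0 + e * t)))"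
    using e by (subst lborel_integral_real_affine[where c = e and t = 0]) auto
  also have "(LBINT t. std_normal_density (0 + e * t) *\<^sub>R iexp (- (2 * pi * z / e) * (0 + e * t)))
      = (LBINT t. (iexp (- (2 * pi * t * z)) * exp (- (e * t)\<^sup>2 / 2)) * complex_of_real (1 / sqrt (2 * pi)))"
    using e unfolding n
    by (intro Bochner_Integration.integral_cong refl)
      (simp add: scaleR_conv_of_real mult.commute mult.left_commute)
  finally have "complex_of_real (exp (- (2 * pi * z / e)\<^sup>2 / 2)) =
     complex_of_real (e / sqrt (2 * pi)) * (LBINT t. iexp (- (2 * pi * t * z)) * exp (- (e * t)\<^sup>2 / 2))"
    unfolding char_std_normal_distribution
    by (simp add: scaleR_conv_of_real)
  then show "(LBINT t. iexp (- (2 * pi * t * z)) * exp (- (e * t)\<^sup>2 / 2))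
       = complex_of_real (sqrt (2 * pi) / e * exp (- (2 * pi * z / e)\<^sup>2 / 2))"
    using e by (simp add: field_simps)
qed

text \<open>Damping the inversion integral by a Gaussian makes it absolutely convergent as a double
  integral. By Fubini, it is then the convolution of \<open>f\<close> with the Fourier transform of the damping
  factor, that is, a normal average of \<open>f\<close> around \<open>y\<close> with standard deviation
  \<open>e / (2 * pi)\<close>.\<close>

lemma gaussian_mean_fourier:
  fixes f :: "real \<Rightarrow> complex"
  assumes f: "integrable lborel f" and e: "0 < e"
  shows "(LBINT t. (iexp (2 * pi * t * y) * fourier f t) * exp (- (e * t)\<^sup>2 / 2))
     = (LBINT s. std_normal_density s *\<^sub>R f (y + e / (2 * pi) * s))"
proof -
  have [measurable]: "f \<in> borel_measurable borel" using f by auto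
  let ?w = "\<lambda>t. complex_of_real (exp (- (e * t)\<^sup>2 / 2))"
  have w: "integrable lborel ?w"
    using integral_iexp_gaussian(1)[OF e] by (rule integrable_of_real)
  have "integrable (lborel \<Otimes>\<^sub>M lborel) (\<lambda>(t, x). ?w t * f x)"
    by (rule lborel_pair.Fubini_integrable)
       (use integral_iexp_gaussian(1)[OF e] w f in \<open>auto simp: norm_mult\<close>)
  then have int: "integrable (lborel \<Otimes>\<^sub>M lborel) (\<lambda>(t, x). iexp (- (2 * pi * t * (x - y))) * ?w t * f x)"
    by (rule Bochner_Integration.integrable_bound) (auto simp: norm_mult split_beta')
  have "(LBINT t. (iexp (2 * pi * t * y) * fourier f t) * ?w t)
     = (LBINT t. LBINT x. iexp (- (2 * pi * t * (x - y))) * ?w t * f x)"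
  proof (intro Bochner_Integration.integral_cong refl)
    fix t
    have "iexp (2 * pi * t * y) * fourier f t * ?w t
       = (LBINT x. (iexp (2 * pi * t * y) * ?w t) * (iexp (- (2 * pi * t * x)) * f x))"
      unfolding fourier_iexp by simp
    also have "\<dots> = (LBINT x. iexp (- (2 * pi * t * (x - y))) * ?w t * f x)"
      by (intro Bochner_Integration.integral_cong refl)
         (simp add: algebra_simps exp_diff exp_minus field_simps)
    finally show "iexp (2 * pi * t * y) * fourier f t * ?w t = \<dots>" .
  qed
  also have "\<dots> = (LBINT x. LBINT t. iexp (- (2 * pi * t * (x - y))) * ?w t * f x)"
    by (rule lborel_pair.Fubini_integral[OF int, symmetric])
  also have "\<dots> = (LBINT x. complex_of_real (sqrt (2 * pi) / e * exp (- (2 * pi * (x - y) / e)\<^sup>2 / 2)) * f x)"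
    by (intro Bochner_Integration.integral_cong refl)
       (simp only: integral_mult_left_zero integral_iexp_gaussian(2)[OF e])
  also have "\<dots> = (e / (2 * pi)) *\<^sub>R (LBINT s. complex_of_real (sqrt (2 * pi) / e *
       exp (- (2 * pi * ((y + e / (2 * pi) * s) - y) / e)\<^sup>2 / 2)) * f (y + e / (2 * pi) * s))"
    using e by (subst lborel_integral_real_affine[where c = "e / (2 * pi)" and t = y]) auto
  also have "\<dots> = (LBINT s. (e / (2 * pi)) *\<^sub>R (complex_of_real (sqrt (2 * pi) / e *
       exp (- (2 * pi * ((y + e / (2 * pi) * s) - y) / e)\<^sup>2 / 2)) * f (y + e / (2 * pi) * s)))"
    by simp
  also have "\<dots> = (LBINT s. std_normal_density s *\<^sub>R f (y + e / (2 * pi) * s))"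
  proof (intro Bochner_Integration.integral_cong refl)
    fix s
    have *: "e / (2 * pi) * (sqrt (2 * pi) / e * exp (- (2 * pi * ((y + e / (2 * pi) * s) - y) / e)\<^sup>2 / 2))
        = std_normal_density s"
      using e by (simp add: std_normal_density_def real_div_sqrt field_simps)
    show "(e / (2 * pi)) *\<^sub>R (complex_of_real (sqrt (2 * pi) / e *
       exp (- (2 * pi * ((y + e / (2 * pi) * s) - y) / e)\<^sup>2 / 2)) * f (y + e / (2 * pi) * s))
       = std_normal_density s *\<^sub>R f (y + e / (2 * pi) * s)"
      unfolding *[symmetric] scaleR_conv_of_real of_real_mult by (simp add: mult.assoc)
  qed
  finally show ?thesis .
qed

text \<open>As \<open>e\<close> tends to 0 in \<open>gaussian_mean_fourier\<close>, the left side tends to the inversion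
  integral because the Fourier transform is integrable, and the right side tends to \<open>f y\<close> because
  \<open>f\<close> is bounded and continuous.\<close>

theorem fourier_inversion:
  fixes f :: "real \<Rightarrow> complex"
  assumes f: "integrable lborel f" "continuous_on UNIV f" and B: "\<And>x. cmod (f x) \<le> B"
    and ft: "integrable lborel (fourier f)"
  shows "f y = (LBINT t. iexp (2 * pi * t * y) * fourier f t)"
proof (rule LIMSEQ_unique)
  have [measurable]: "f \<in> borel_measurable borel" using f by auto
  define e where "e k = inverse (real (Suc k))" for k
  have e: "0 < e k" for k by (simp add: e_def)
  have e0: "e \<longlonglongrightarrow> 0" unfolding e_def by (rule LIMSEQ_inverse_real_of_nat)
  let ?A = "\<lambda>k. LBINT t. (iexp (2 * pi * t * y) * fourier f t) * exp (- (e k * t)\<^sup>2 / 2)"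
  have "?A \<longlonglongrightarrow> (LBINT t. (iexp (2 * pi * t * y) * fourier f t))"
  proof (rule integral_dominated_convergence[where w = "\<lambda>t. cmod (fourier f t)"])
    show "integrable lborel (\<lambda>t. cmod (fourier f t))" using ft by (rule integrable_norm)
    show "AE t in lborel. (\<lambda>k. (iexp (2 * pi * t * y) * fourier f t) * exp (- (e k * t)\<^sup>2 / 2))
       \<longlonglongrightarrow> iexp (2 * pi * t * y) * fourier f t"
    proof (rule AE_I2)
      fix t
      have "(\<lambda>k. (iexp (2 * pi * t * y) * fourier f t) * complex_of_real (exp (- (e k * t)\<^sup>2 / 2)))
       \<longlonglongrightarrow> (iexp (2 * pi * t * y) * fourier f t) * complex_of_real (exp (- (0 * t)\<^sup>2 / 2))"
        by (intro tendsto_intros e0) simp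
      then show "(\<lambda>k. (iexp (2 * pi * t * y) * fourier f t) * exp (- (e k * t)\<^sup>2 / 2))
       \<longlonglongrightarrow> iexp (2 * pi * t * y) * fourier f t" by simp
    qed
  qed (auto simp: norm_mult intro!: mult_left_le)
  then show "?A \<longlonglongrightarrow> (LBINT t. iexp (2 * pi * t * y) * fourier f t)" .
  have "(\<lambda>k. LBINT s. std_normal_density s *\<^sub>R f (y + e k / (2 * pi) * s))
      \<longlonglongrightarrow> (LBINT s. std_normal_density s *\<^sub>R f y)"
  proof (rule integral_dominated_convergence[where w = "\<lambda>s. std_normal_density s * B"])
    show "AE s in lborel. (\<lambda>k. std_normal_density s *\<^sub>R f (y + e k / (2 * pi) * s))
        \<longlonglongrightarrow> std_normal_density s *\<^sub>R f y"
    proof (rule AE_I2)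
      fix s
      have "(\<lambda>k. y + e k / (2 * pi) * s) \<longlonglongrightarrow> y + 0 / (2 * pi) * s"
        by (intro tendsto_intros e0) simp
      then have "(\<lambda>k. f (y + e k / (2 * pi) * s)) \<longlonglongrightarrow> f y"
        using f(2) by (intro isCont_tendsto_compose[of _ f]) (auto simp: continuous_on_eq_continuous_at)
      then show "(\<lambda>k. std_normal_density s *\<^sub>R f (y + e k / (2 * pi) * s))
        \<longlonglongrightarrow> std_normal_density s *\<^sub>R f y" by (intro tendsto_intros)
    qed
  qed (auto simp: B mult_left_mono)
  also have "(LBINT s. std_normal_density s *\<^sub>R f y) = f y"
    using integral_normal_density[of 1 0] by simp
  finally show "?A \<longlonglongrightarrow> f y"
    unfolding gaussian_mean_fourier[OF f(1) e] .
qed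

text \<open>Writing \<open>f\<close> by Fourier inversion and exchanging the integrals gives the Parseval identity
  \<open>\<integral> f g = \<integral> f^(t) g^(-t) dt\<close>. Only the sup norm of \<open>g^\<close> enters the bound, so \<open>g\<close> may
  have an arbitrarily large integral norm.\<close>

lemma cmod_integral_mult_le:
  fixes f g :: "real \<Rightarrow> complex"
  assumes f: "integrable lborel f" "continuous_on UNIV f" "\<And>x. cmod (f x) \<le> B"
    and ft: "integrable lborel (fourier f)"
    and g: "integrable lborel g" and gt: "\<And>t. cmod (fourier g t) \<le> D"
  shows "cmod (LBINT x. f x * g x) \<le> D * (LBINT t. cmod (fourier f t))"
proof -
  have [measurable]: "f \<in> borel_measurable borel" "g \<in> borel_measurable borel" using f g by auto
  have "integrable (lborel \<Otimes>\<^sub>M lborel) (\<lambda>(t, x). fourier f t * g x)"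
    by (rule lborel_pair.Fubini_integrable)
       (use ft g in \<open>auto simp: norm_mult intro: integrable_norm\<close>)
  then have int: "integrable (lborel \<Otimes>\<^sub>M lborel) (\<lambda>(t, x). iexp (2 * pi * t * x) * fourier f t * g x)"
    by (rule Bochner_Integration.integrable_bound) (auto simp: norm_mult split_beta')
  have "(LBINT x. f x * g x) = (LBINT x. LBINT t. iexp (2 * pi * t * x) * fourier f t * g x)"
    by (intro Bochner_Integration.integral_cong refl)
       (simp only: integral_mult_left_zero fourier_inversion[OF f ft, symmetric])
  also have "\<dots> = (LBINT t. LBINT x. iexp (2 * pi * t * x) * fourier f t * g x)"
    by (rule lborel_pair.Fubini_integral[OF int])
  also have "\<dots> = (LBINT t. fourier f t * fourier g (- t))"
  proof (intro Bochner_Integration.integral_cong refl)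
    fix t
    have "(LBINT x. iexp (2 * pi * t * x) * fourier f t * g x)
       = (LBINT x. fourier f t * (iexp (- (2 * pi * (- t) * x)) * g x))"
      by (intro Bochner_Integration.integral_cong refl) (simp add: mult_ac)
    then show "(LBINT x. iexp (2 * pi * t * x) * fourier f t * g x) = fourier f t * fourier g (- t)"
      by (simp add: fourier_iexp[of g])
  qed
  finally have "cmod (LBINT x. f x * g x) \<le> (LBINT t. cmod (fourier f t * fourier g (- t)))"
    using integral_norm_bound by metis
  also have "\<dots> \<le> (LBINT t. D * cmod (fourier f t))"
  proof (rule integral_mono_AE')
    show "integrable lborel (\<lambda>t. D * cmod (fourier f t))"
      using ft by (intro integrable_mult_right integrable_norm)
    have "0 \<le> D" using gt[of 0] norm_ge_zero order_trans by blast
    then show "AE t in lborel. 0 \<le> D * cmod (fourier f t)" by simp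
    show "AE t in lborel. cmod (fourier f t * fourier g (- t)) \<le> D * cmod (fourier f t)"
      using mult_right_mono[OF gt norm_ge_zero]
      by (intro AE_I2) (simp add: norm_mult mult.commute)
  qed
  finally show ?thesis by simp
qed

lemma integrable_inverse_1_plus_square_lborel: "integrable lborel (\<lambda>x::real. inverse (1 + x\<^sup>2))"
  using integrable_inverse_1_plus_square by (simp add: set_integrable_def)

lemma integral_inverse_1_plus_square_lborel: "(LBINT x::real. inverse (1 + x\<^sup>2)) = pi"
  using LBINT_inverse_1_plus_square
  by (simp add: interval_lebesgue_integral_def set_lebesgue_integral_def)

text \<open>Comparison with the weight \<open>1 / (1 + x\<^sup>2)\<close>, whose integral is \<open>pi\<close>. It is used
  both for Schwartz functions and for their Fourier transforms.\<close>

lemma norm_le_inverse_1_plus_square: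
  fixes f :: "real \<Rightarrow> complex"
  assumes [measurable]: "f \<in> borel_measurable borel" and "\<And>x. (1 + x\<^sup>2) * cmod (f x) \<le> C"
  shows "integrable lborel f" "(LBINT x. cmod (f x)) \<le> C * pi"
proof -
  have le: "cmod (f x) \<le> C * inverse (1 + x\<^sup>2)" for x
    using assms(2)[of x] by (simp add: field_simps add_pos_nonneg)
  have int: "integrable lborel (\<lambda>x. C * inverse (1 + x\<^sup>2))"
    by (intro integrable_mult_right integrable_inverse_1_plus_square_lborel)
  show "integrable lborel f"
    by (rule Bochner_Integration.integrable_bound[OF int]) 
      (auto intro!: AE_I2 order_trans[OF le abs_ge_self] simp del: abs_mult)
  then have "(LBINT x. cmod (f x)) \<le> (LBINT x. C * inverse (1 + x\<^sup>2))"
    by (intro integral_mono integrable_norm int le)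
  then show "(LBINT x. cmod (f x)) \<le> C * pi"
    by (simp add: integral_inverse_1_plus_square_lborel)
qed

text \<open>Both integrations by parts are done at once: with \<open>w = 2 * pi * t\<close> and
  \<open>E x = iexp (- (w * x))\<close>, the function \<open>F = f' E + \<i> w f E\<close> vanishes at infinity and has the
  derivative \<open>f'' E + w\<^sup>2 f E\<close>, whose integral is therefore zero.\<close>

lemma fourier_deriv2:
  fixes f f' f'' :: "real \<Rightarrow> complex"
  assumes d1: "\<And>x. (f has_vector_derivative f' x) (at x)"
    and d2: "\<And>x. (f' has_vector_derivative f'' x) (at x)"
    and c: "continuous_on UNIV f''"
    and int: "integrable lborel f" "integrable lborel f''"
    and lim: "(f \<longlongrightarrow> 0) at_infinity" "(f' \<longlongrightarrow> 0) at_infinity"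
  shows "fourier f'' t = - (2 * pi * t)\<^sup>2 * fourier f t"
proof -
  define w where "w = 2 * pi * t"
  define E where "E x = iexp (- (w * x))" for x
  have dE: "(E has_vector_derivative (- (\<i> * w) * E x)) (at x)" for x
    unfolding E_def
    by (rule has_vector_derivative_eq_rhs, rule field_vector_diff_chain_at[of _ _ _ exp, unfolded o_def])
       (auto intro!: derivative_eq_intros)
  have nE: "cmod (E x) = 1" for x by (simp add: E_def)
  have cE: "continuous_on UNIV E"
    unfolding E_def by (intro continuous_intros)
  have cf: "continuous_on UNIV f"
    using d1 by (intro continuous_at_imp_continuous_on ballI has_vector_derivative_continuous)
  define F where "F x = f' x * E x + (\<i> * w) * (f x * E x)" for x
  define H where "H x = E x * f'' x + w\<^sup>2 * (E x * f x)" for x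
  have dF: "(F has_vector_derivative H x) (at x)" for x
    unfolding F_def H_def
    by (rule has_vector_derivative_eq_rhs, (rule derivative_intros d1 d2 dE)+)
       (simp add: algebra_simps power2_eq_square)
  have cH: "isCont H x" for x
    unfolding H_def using cE c cf
    by (intro continuous_intros) (auto simp: continuous_on_eq_continuous_at)
  have intE: "integrable lborel (\<lambda>x. E x * h x)" if "integrable lborel h" for h :: "real \<Rightarrow> complex"
    by (rule Bochner_Integration.integrable_bound[OF that])
       (use that borel_measurable_continuous_onI[OF cE] in \<open>auto simp: norm_mult nE\<close>)
  have intH: "integrable lborel H"
    unfolding H_def by (intro Bochner_Integration.integrable_add integrable_mult_right intE int)
  have limF: "(F \<longlongrightarrow> 0) at_infinity"
  proof (rule Lim_null_comparison)
    show "\<forall>\<^sub>F x in at_infinity. norm (F x) \<le> cmod (f' x) + \<bar>w\<bar> * cmod (f x)"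
      by (intro always_eventually allI order_trans[OF norm_triangle_ineq] )
         (auto simp: F_def norm_mult nE intro: order_trans[OF norm_triangle_ineq])
    show "((\<lambda>x. cmod (f' x) + \<bar>w\<bar> * cmod (f x)) \<longlongrightarrow> 0) at_infinity"
      by (rule tendsto_eq_intros lim[THEN tendsto_norm] refl | simp)+
  qed
  have "(LBINT x=-\<infinity>..\<infinity>. H x) = 0 - 0"
  proof (rule interval_integral_FTC_integrable[where F = F])
    show "set_integrable lborel (einterval (-\<infinity>) \<infinity>) H"
      using intH by (simp add: set_integrable_def)
    show "((F \<circ> real_of_ereal) \<longlongrightarrow> 0) (at_right (-\<infinity>))" "((F \<circ> real_of_ereal) \<longlongrightarrow> 0) (at_left \<infinity>)"
      using limF unfolding ereal_tendsto_simps at_infinity_eq_at_top_bot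
      by (auto simp: filterlim_sup intro: tendsto_mono[OF sup_ge1] tendsto_mono[OF sup_ge2])
  qed (use dF cH in auto)
  then have "(LBINT x. H x) = 0"
    by (simp add: interval_lebesgue_integral_def set_lebesgue_integral_def)
  also have "(LBINT x. H x) = fourier f'' t + w\<^sup>2 * fourier f t"
    unfolding H_def fourier_iexp
    using intE[OF int(1)] intE[OF int(2)]
    by (simp add: E_def w_def)
  finally show ?thesis by (simp add: w_def add_eq_0_iff)
qed

section \<open>Schwartz functions and tempered series\<close>

lemma smooth_has_vector_derivative:
  "smooth f \<Longrightarrow> (iter_deriv m f has_vector_derivative iter_deriv (Suc m) f x) (at x)"
  unfolding smooth_def by (simp add: iter_deriv_def vector_derivative_works)

lemma continuous_on_iter_deriv: "smooth f \<Longrightarrow> continuous_on UNIV (iter_deriv m f)"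
  by (auto intro!: continuous_at_imp_continuous_on
      intro: has_vector_derivative_continuous smooth_has_vector_derivative)

lemma iter_deriv_0 [simp]: "iter_deriv 0 f = f"
  by (simp add: iter_deriv_def)

lemma schwartz_seminorm_upper:
  "f \<in> schwartz_space \<Longrightarrow> \<bar>x\<bar> ^ k * cmod (iter_deriv m f x) \<le> schwartz_seminorm k m f"
  unfolding schwartz_seminorm_def schwartz_space_def by (auto intro!: cSUP_upper)

lemma schwartz_seminorm_nonneg: "f \<in> schwartz_space \<Longrightarrow> 0 \<le> schwartz_seminorm k m f"
  by (rule order_trans[OF _ schwartz_seminorm_upper[of f 0]]) auto

lemma schwartz_decay:
  assumes "f \<in> schwartz_space"
  shows "(1 + x\<^sup>2) * cmod (iter_deriv m f x) \<le> schwartz_seminorm 0 m f + schwartz_seminorm 2 m f"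
  using schwartz_seminorm_upper[OF assms, of x 0 m] schwartz_seminorm_upper[OF assms, of x 2 m]
  by (simp add: distrib_right)

lemma schwartz_tendsto_0:
  assumes f: "f \<in> schwartz_space"
  shows "(iter_deriv m f \<longlongrightarrow> 0) at_infinity"
proof (rule Lim_null_comparison)
  show "\<forall>\<^sub>F x in at_infinity. norm (iter_deriv m f x) \<le> schwartz_seminorm 1 m f * norm (inverse x)"
  proof (rule eventually_mono[OF eventually_not_equal_at_infinity[of 0]])
    fix x :: real assume "x \<noteq> 0"
    then show "norm (iter_deriv m f x) \<le> schwartz_seminorm 1 m f * norm (inverse x)"
      using schwartz_seminorm_upper[OF f, of x 1 m] by (simp add: field_simps)
  qed
  show "((\<lambda>x::real. schwartz_seminorm 1 m f * norm (inverse x)) \<longlongrightarrow> 0) at_infinity"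
    by (intro tendsto_mult_right_zero tendsto_norm_zero tendsto_inverse_0)
qed

text \<open>The second derivative turns into the factor \<open>(2 * pi * t)\<^sup>2\<close>, which dominates
  \<open>t\<^sup>2\<close>; so the integrals of \<open>f\<close> and of its second derivative bound
  \<open>(1 + t\<^sup>2) f^(t)\<close> uniformly in \<open>t\<close>. One factor \<open>pi\<close> comes from these integrals, the
  other from integrating over \<open>t\<close>.\<close>

lemma schwartz_fourier_L1:
  assumes f: "f \<in> schwartz_space"
  shows "integrable lborel f" and "integrable lborel (fourier f)"
    and "(LBINT t. cmod (fourier f t)) \<le> pi\<^sup>2 * (\<Sum>k\<le>2. \<Sum>m\<le>2. schwartz_seminorm k m f)"
proof -
  let ?s = "\<lambda>k m. schwartz_seminorm k m f"
  have sm: "smooth f" using f by (simp add: schwartz_space_def)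
  have [measurable]: "iter_deriv m f \<in> borel_measurable borel" for m
    by (rule borel_measurable_continuous_onI[OF continuous_on_iter_deriv[OF sm]])
  have [measurable]: "f \<in> borel_measurable borel"
    using borel_measurable_continuous_onI[OF continuous_on_iter_deriv[OF sm, of 0]] by simp
  have int: "integrable lborel (iter_deriv m f)"
    and le: "(LBINT x. cmod (iter_deriv m f x)) \<le> (?s 0 m + ?s 2 m) * pi" for m
    using norm_le_inverse_1_plus_square[OF _ schwartz_decay[OF f], of m] by auto
  show "integrable lborel f" using int[of 0] by simp
  have F2: "fourier (iter_deriv 2 f) t = - (2 * pi * t)\<^sup>2 * fourier f t" for t
  proof (rule fourier_deriv2)
    show "(f has_vector_derivative iter_deriv 1 f x) (at x)" for x
      using smooth_has_vector_derivative[OF sm, of 0] by simp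
    show "(iter_deriv 1 f has_vector_derivative iter_deriv 2 f x) (at x)" for x
      using smooth_has_vector_derivative[OF sm, of 1] by (simp add: numeral_2_eq_2)
  qed (use int[of 0] int[of 2] continuous_on_iter_deriv[OF sm] schwartz_tendsto_0[OF f]
      schwartz_tendsto_0[OF f, of 0] in auto)
  have bound: "(1 + t\<^sup>2) * cmod (fourier f t) \<le> ((?s 0 0 + ?s 2 0) + (?s 0 2 + ?s 2 2)) * pi" for t
  proof -
    have "1 * 1 \<le> (2 * pi) * (2 * pi)" using pi_gt3 by (intro mult_mono) auto
    then have "t\<^sup>2 \<le> (2 * pi * t)\<^sup>2"
      using mult_right_mono[of 1 "(2 * pi) * (2 * pi)" "t\<^sup>2"] by (simp add: power2_eq_square mult_ac)
    then have "(1 + t\<^sup>2) * cmod (fourier f t) \<le> (1 + (2 * pi * t)\<^sup>2) * cmod (fourier f t)"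
      by (intro mult_right_mono) auto
    also have "\<dots> = cmod (fourier f t) + cmod (fourier (iter_deriv 2 f) t)"
      unfolding F2 by (simp add: norm_mult norm_power power_mult_distrib distrib_right)
    also have "\<dots> \<le> (LBINT x. cmod (iter_deriv 0 f x)) + (LBINT x. cmod (iter_deriv 2 f x))"
      using cmod_fourier_le[of f] cmod_fourier_le[of "iter_deriv 2 f"] by (intro add_mono) auto
    also have "\<dots> \<le> (?s 0 0 + ?s 2 0) * pi + (?s 0 2 + ?s 2 2) * pi"
      by (intro add_mono le)
    finally show ?thesis by (simp add: distrib_right)
  qed
  note L = norm_le_inverse_1_plus_square[OF borel_measurable_fourier bound]
  show "integrable lborel (fourier f)" by (rule L) measurable
  have "(LBINT t. cmod (fourier f t)) \<le> ((?s 0 0 + ?s 2 0) + (?s 0 2 + ?s 2 2)) * pi * pi"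
    by (rule L) measurable
  also have "\<dots> = pi\<^sup>2 * ((?s 0 0 + ?s 2 0) + (?s 0 2 + ?s 2 2))"
    by (simp add: power2_eq_square)
  also have "\<dots> \<le> pi\<^sup>2 * (\<Sum>k\<le>2. \<Sum>m\<le>2. ?s k m)"
    using schwartz_seminorm_nonneg[OF f]
    by (intro mult_left_mono) (simp_all add: numeral_2_eq_2 add_nonneg_nonneg)
  finally show "(LBINT t. cmod (fourier f t)) \<le> pi\<^sup>2 * (\<Sum>k\<le>2. \<Sum>m\<le>2. ?s k m)" .
qed

lemma integrable_mult_Cc:
  fixes f h :: "real \<Rightarrow> complex"
  assumes "continuous_on UNIV f" "h \<in> Cc"
  shows "integrable lborel (\<lambda>x. f x * h x)"
  using integrable_Cc[OF Cc_mult_continuous[OF assms(2,1)]] by (simp add: mult.commute)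

text \<open>The bound \<open>cmod_integral_mult_le\<close> makes the series absolutely convergent, with a majorant
  that depends on \<open>f\<close> only through the integral norm of its Fourier transform.\<close>

lemma tempered_distribution_series:
  fixes h :: "nat \<Rightarrow> real \<Rightarrow> complex"
  assumes h: "\<And>n. h n \<in> Cc" and D: "summable D" "\<And>n t. cmod (fourier (h n) t) \<le> D n"
  shows "tempered_distribution (\<lambda>f. \<Sum>n. LBINT x. f x * h n x)"
proof -
  have cont: "continuous_on UNIV f" if "f \<in> schwartz_space" for f
    using continuous_on_iter_deriv[of f 0] that by (simp add: schwartz_space_def)
  have term_le: "cmod (LBINT x. f x * h n x) \<le> D n * (LBINT t. cmod (fourier f t))"
    if f: "f \<in> schwartz_space" for f n
  proof (rule cmod_integral_mult_le[where B = "schwartz_seminorm 0 0 f"])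
    show "cmod (f x) \<le> schwartz_seminorm 0 0 f" for x
      using schwartz_seminorm_upper[OF f, of x 0 0] by simp
    show "integrable lborel (h n)" by (rule integrable_Cc[OF h])
  qed (use f schwartz_fourier_L1[OF f] cont D in auto)
  have summ: "summable (\<lambda>n. LBINT x. f x * h n x)" if f: "f \<in> schwartz_space" for f
    by (rule summable_comparison_test'[OF summable_mult2[OF D(1)] term_le[OF f]])
  note int = integrable_mult_Cc[OF cont h]
  show ?thesis
    unfolding tempered_distribution_def complex_linear_on_def
  proof (intro conjI ballI allI exI)
    fix f k :: "real \<Rightarrow> complex" assume "f \<in> schwartz_space" "k \<in> schwartz_space"
    then show "(\<Sum>n. LBINT x. (f x + k x) * h n x) = (\<Sum>n. LBINT x. f x * h n x) + (\<Sum>n. LBINT x. k x * h n x)"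
      by (simp add: distrib_right int suminf_add summ)
  next
    fix c and f :: "real \<Rightarrow> complex" assume "f \<in> schwartz_space"
    then show "(\<Sum>n. LBINT x. c * f x * h n x) = c * (\<Sum>n. LBINT x. f x * h n x)"
      by (simp add: mult.assoc suminf_mult summ)
  next
    fix f assume f: "f \<in> schwartz_space"
    let ?L = "LBINT t. cmod (fourier f t)"
    have "0 \<le> D n" for n using D(2)[of n 0] norm_ge_zero order_trans by blast
    then have S0: "0 \<le> suminf D" by (intro suminf_nonneg D)
    have "cmod (\<Sum>n. LBINT x. f x * h n x) \<le> (\<Sum>n. D n * ?L)"
      by (rule norm_suminf_le[OF term_le[OF f] summable_mult2[OF D(1)]])
    also have "\<dots> = suminf D * ?L" by (rule suminf_mult2[OF D(1), symmetric])
    also have "\<dots> \<le> suminf D * (pi\<^sup>2 * (\<Sum>k\<le>2. \<Sum>m\<le>2. schwartz_seminorm k m f))"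
      by (intro mult_left_mono schwartz_fourier_L1(3) f S0)
    finally show "cmod (\<Sum>n. LBINT x. f x * h n x)
       \<le> (suminf D * pi\<^sup>2) * (\<Sum>k\<le>2. \<Sum>m\<le>2. schwartz_seminorm k m f)"
      by (simp add: mult.assoc)
  qed
qed

section \<open>Locally finite series of functions\<close>

lemma locally_finite_suminf_eq_sum:
  fixes h :: "nat \<Rightarrow> real \<Rightarrow> complex"
  assumes zero: "\<And>n x. \<bar>x\<bar> < real n \<Longrightarrow> h n x = 0" and x: "\<bar>x\<bar> < real N"
  shows "(\<Sum>n. h n x) = (\<Sum>n<N. h n x)"
  by (rule suminf_finite) (use x in \<open>auto intro!: zero\<close>)

lemma continuous_on_locally_finite_suminf:
  fixes h :: "nat \<Rightarrow> real \<Rightarrow> complex"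
  assumes cont: "\<And>n. continuous_on UNIV (h n)"
    and zero: "\<And>n x. \<bar>x\<bar> < real n \<Longrightarrow> h n x = 0"
  shows "continuous_on UNIV (\<lambda>x. \<Sum>n. h n x)"
proof (intro continuous_at_imp_continuous_on ballI)
  fix x :: real
  obtain N where N: "\<bar>x\<bar> < real N" using reals_Archimedean2 by blast
  have "continuous_on {- real N<..<real N} (\<lambda>x. \<Sum>n. h n x) \<longleftrightarrow>
      continuous_on {- real N<..<real N} (\<lambda>x. \<Sum>n<N. h n x)"
    by (intro continuous_on_cong refl locally_finite_suminf_eq_sum zero) auto
  moreover have "continuous_on {- real N<..<real N} (\<lambda>x. \<Sum>n<N. h n x)"
    by (intro continuous_on_sum continuous_on_subset[OF cont]) simp
  ultimately show "isCont (\<lambda>x. \<Sum>n. h n x) x"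
    using N by (simp add: continuous_on_eq_continuous_at[of "{- real N<..<real N}"] abs_less_iff)
qed

text \<open>A test function of compact support meets only finitely many of the \<open>h n\<close>, so summation and
  integration commute for finite sums already.\<close>

lemma integral_locally_finite_suminf:
  fixes h :: "nat \<Rightarrow> real \<Rightarrow> complex"
  assumes cont: "\<And>n. continuous_on UNIV (h n)"
    and zero: "\<And>n x. \<bar>x\<bar> < real n \<Longrightarrow> h n x = 0"
    and \<phi>: "\<phi> \<in> Cc"
  shows "(\<lambda>n. LBINT x. \<phi> x * h n x) sums (LBINT x. \<phi> x * (\<Sum>n. h n x))"
proof -
  obtain R where R: "\<And>x. R < \<bar>x\<bar> \<Longrightarrow> \<phi> x = 0" using \<phi> by (auto simp: Cc_iff)
  obtain N where N: "R < real N" using reals_Archimedean2 by blast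
  have 0: "\<phi> x * h n x = 0" if "n \<ge> N" for n x
  proof (cases "R < \<bar>x\<bar>")
    case False
    then have "\<bar>x\<bar> < real n" using N that by simp
    then show ?thesis by (simp add: zero)
  qed (simp add: R)
  have eq: "\<phi> x * (\<Sum>n. h n x) = (\<Sum>n<N. \<phi> x * h n x)" for x
  proof (cases "R < \<bar>x\<bar>")
    case False
    then have "\<bar>x\<bar> < real N" using N by simp
    then show ?thesis
      by (subst locally_finite_suminf_eq_sum[OF zero]) (simp_all add: sum_distrib_left)
  qed (simp add: R)
  have "(\<lambda>n. LBINT x. \<phi> x * h n x) sums (\<Sum>n<N. LBINT x. \<phi> x * h n x)"
    by (rule sums_finite) (auto simp: 0)
  also have "(\<Sum>n<N. LBINT x. \<phi> x * h n x) = (LBINT x. \<phi> x * (\<Sum>n. h n x))"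
    unfolding eq
    by (rule Bochner_Integration.integral_sum[symmetric]) (intro integrable_Cc Cc_mult_continuous \<phi> cont)
  finally show ?thesis .
qed

section \<open>Densities of superpolynomial mass\<close>

lemma poly_growth:
  fixes P :: "complex poly"
  obtains C where "0 < C" "\<And>z. 1 + cmod (poly P z) \<le> C * (1 + cmod z) ^ degree P"
proof
  let ?S = "\<Sum>i\<le>degree P. cmod (coeff P i)"
  show "0 < 1 + ?S" by (intro add_pos_nonneg sum_nonneg) auto
  fix z
  have "cmod (poly P z) \<le> (\<Sum>i\<le>degree P. cmod (coeff P i * z ^ i))"
    unfolding poly_altdef by (rule norm_sum)
  also have "\<dots> \<le> (\<Sum>i\<le>degree P. cmod (coeff P i) * (1 + cmod z) ^ degree P)"
  proof (intro sum_mono)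
    fix i assume "i \<in> {..degree P}"
    then have "cmod z ^ i \<le> (1 + cmod z) ^ degree P"
      by (intro order_trans[OF power_mono[of "cmod z" "1 + cmod z"] power_increasing]) auto
    then show "cmod (coeff P i * z ^ i) \<le> cmod (coeff P i) * (1 + cmod z) ^ degree P"
      by (simp add: norm_mult norm_power mult_left_mono)
  qed
  also have "\<dots> = ?S * (1 + cmod z) ^ degree P" by (simp add: sum_distrib_right)
  finally have "cmod (poly P z) \<le> ?S * (1 + cmod z) ^ degree P" .
  moreover have "1 \<le> (1 + cmod z) ^ degree P" by (rule one_le_power) simp
  ultimately show "1 + cmod (poly P z) \<le> (1 + ?S) * (1 + cmod z) ^ degree P"
    unfolding distrib_right by linarith
qed

text \<open>On the set where \<open>h n\<close> does not vanish, the weight \<open>1 + \<bar>P\<bar>\<close> is at most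
  \<open>C (2 b)\<^sup>d\<close> with \<open>b = (n + 1)\<^sup>2 + 1\<close> and \<open>d\<close> the degree of \<open>P\<close>, whereas
  \<open>h n\<close> has mass at least \<open>b ^ (n + 1)\<close>. If the weighted total mass were a finite \<open>I\<close>, then
  \<open>n \<le> b ^ (n + 1 - d) \<le> I C 2\<^sup>d\<close> for all \<open>n \<ge> d\<close>.\<close>

lemma not_slowly_increasing_density:
  fixes G :: "real \<Rightarrow> complex" and h :: "nat \<Rightarrow> real \<Rightarrow> complex"
  assumes G: "continuous_on UNIV G"
    and \<mu>: "\<And>\<phi>. \<phi> \<in> Cc \<Longrightarrow> \<mu> \<phi> = (LBINT x. \<phi> x * G x)"
    and h: "\<And>n. h n \<in> Cc"
    and hG: "\<And>n x. h n x \<noteq> 0 \<Longrightarrow> G x = h n x \<and> \<bar>x\<bar> \<le> real n + 2"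
    and big: "\<And>n. ((real (Suc n))\<^sup>2 + 1) ^ Suc n \<le> L1_norm (h n)"
  shows "\<not> slowly_increasing \<mu>"
proof
  assume "slowly_increasing \<mu>"
  then obtain P where fin: "(\<integral>\<^sup>+x. ennreal (1 / (1 + cmod (poly P (of_real x)))) \<partial>total_variation \<mu>) < \<infinity>"
    unfolding slowly_increasing_def by auto
  have [measurable]: "G \<in> borel_measurable borel" "h n \<in> borel_measurable borel" for n
    using G Cc_continuous[OF h] by (auto intro: borel_measurable_continuous_onI)
  have [measurable]: "(\<lambda>x. poly P (complex_of_real x)) \<in> borel_measurable borel"
    by (intro borel_measurable_continuous_onI continuous_intros)
  let ?p = "\<lambda>x. 1 + cmod (poly P (complex_of_real x))"
  have p: "0 < ?p x" for x by (simp add: add_pos_nonneg)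
  have tv: "total_variation \<mu> = density lborel (\<lambda>x. ennreal (cmod (G x)))"
    by (rule total_variation_density[OF G \<mu>])
  have "(\<integral>\<^sup>+x. ennreal (1 / ?p x) \<partial>total_variation \<mu>) = (\<integral>\<^sup>+x. ennreal (cmod (G x)) * ennreal (1 / ?p x) \<partial>lborel)"
    unfolding tv by (subst nn_integral_density) auto
  also have "\<dots> = (\<integral>\<^sup>+x. ennreal (cmod (G x) / ?p x) \<partial>lborel)"
    using p by (intro nn_integral_cong) (simp flip: ennreal_mult')
  finally obtain I where I: "0 \<le> I" "(\<integral>\<^sup>+x. ennreal (cmod (G x) / ?p x) \<partial>lborel) = ennreal I"
    using fin by (metis ennreal_cases infinity_ennreal_def less_irrefl)
  obtain C where C: "0 < C" "\<And>z. 1 + cmod (poly P z) \<le> C * (1 + cmod z) ^ degree P"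
    using poly_growth[of P] by blast
  let ?d = "degree P"
  have "real n \<le> I * C * 2 ^ ?d" if n: "?d \<le> n" for n
  proof -
    define b where "b = (real (Suc n))\<^sup>2 + 1"
    define K where "K = C * (2 * b) ^ ?d"
    have "real n \<le> (real n)\<^sup>2" by (cases n) (auto simp: power2_eq_square)
    then have b: "real n + 1 \<le> b" "real n + 3 \<le> 2 * b" "1 \<le> b"
      by (auto simp: b_def power2_eq_square algebra_simps)
    have K: "0 < K" using C b by (simp add: K_def)
    have le: "cmod (h n x) / K \<le> cmod (G x) / ?p x" for x
    proof (cases "h n x = 0")
      case True
      then show ?thesis using p[of x] by simp
    next
      case False
      from hG[OF this] have G: "G x = h n x" and x: "\<bar>x\<bar> \<le> real n + 2" by auto
      have "?p x \<le> C * (1 + \<bar>x\<bar>) ^ ?d" using C(2)[of "complex_of_real x"] by simp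
      also have "\<dots> \<le> K"
        unfolding K_def using C(1) x b by (intro mult_left_mono power_mono) auto
      finally show ?thesis
        unfolding G using p[of x] by (intro divide_left_mono) (auto intro: mult_pos_pos K)
    qed
    have int: "integrable lborel (\<lambda>x. cmod (h n x) / K)"
      using integrable_Cc[OF h] by (intro integrable_divide integrable_norm)
    have "ennreal (L1_norm (h n) / K) = (\<integral>\<^sup>+x. ennreal (cmod (h n x) / K) \<partial>lborel)"
      using K by (subst nn_integral_eq_integral[OF int]) (auto simp: L1_norm_def)
    also have "\<dots> \<le> ennreal I"
      unfolding I(2)[symmetric] by (intro nn_integral_mono ennreal_leI le)
    finally have "L1_norm (h n) / K \<le> I" using I(1) by simp
    then have "b ^ Suc n \<le> I * K"
      using big[of n] K by (simp add: b_def pos_divide_le_eq)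
    moreover have "b ^ Suc n = b ^ (Suc n - ?d) * b ^ ?d"
      using n by (simp flip: power_add)
    ultimately have "b ^ (Suc n - ?d) * b ^ ?d \<le> (I * C * 2 ^ ?d) * b ^ ?d"
      by (simp add: K_def power_mult_distrib mult_ac)
    then have "b ^ (Suc n - ?d) \<le> I * C * 2 ^ ?d"
      using b by (simp add: mult_le_cancel_right)
    moreover have "b ^ 1 \<le> b ^ (Suc n - ?d)"
      using b n by (intro power_increasing) auto
    ultimately show ?thesis using b by simp
  qed
  moreover obtain m where "I * C * 2 ^ ?d < real m" using reals_Archimedean2 by blast
  ultimately show False
    by (metis le_less_trans less_le_not_le linorder_le_cases max.cobounded1 max.cobounded2 of_nat_mono order_trans)
qed

section \<open>A tempered measure that is not slowly increasing\<close>

theorem proposition3p6: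
  fixes g :: "nat \<Rightarrow> real \<Rightarrow> complex"
  assumes "\<And>n. n \<ge> 1 \<Longrightarrow> g n \<in> Cc"
    and "\<And>n. n \<ge> 1 \<Longrightarrow> supp (g n) \<subseteq> {- (1 / (real n + 1)) .. 1 / (real n + 1)}"
    and "\<And>n. n \<ge> 1 \<Longrightarrow> L1_norm (g n) \<ge> ((real n)\<^sup>2 + 1) ^ n"
    and "\<And>n. n \<ge> 1 \<Longrightarrow> sup_norm (fourier (g n)) \<le> (1 / 2) ^ n"
  shows "\<exists>\<mu>. converges_vaguely (\<lambda>n \<phi>. \<Sum>j=1..n. (LBINT x. \<phi> x * g j (x + real j))) \<mu>
           \<and> radon_measure \<mu>
           \<and> ((\<forall>n\<ge>1. \<forall>x. g n x \<in> \<real>) \<longrightarrow> signed_radon_measure \<mu>)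
           \<and> tempered \<mu>
           \<and> \<not> slowly_increasing \<mu>"
proof -
  \<comment> \<open>the index is shifted by one, so that the series starts at 0\<close>
  define h where "h n x = g (Suc n) (x + real (Suc n))" for n x
  define G where "G x = (\<Sum>n. h n x)" for x
  \<comment> \<open>Taken as the series rather than as integration against \<open>G\<close>: that integral need
    not converge absolutely for a Schwartz function, whereas the series does, so that the same
    functional serves as the tempered distribution.\<close>
  define \<mu> where "\<mu> = (\<lambda>\<phi>. \<Sum>n. LBINT x. \<phi> x * h n x)"
  have near: "\<bar>x + real (Suc n)\<bar> \<le> 1 / (real n + 2)" if "h n x \<noteq> 0" for n x
  proof -
    have "x + real (Suc n) \<in> supp (g (Suc n))"
      using that zero_outside_supp unfolding h_def by blast
    with assms(2)[of "Suc n"] have "x + real (Suc n) \<in> {- (1 / (real (Suc n) + 1)) .. 1 / (real (Suc n) + 1)}"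
      by auto
    then show ?thesis by (simp add: abs_le_iff add_ac)
  qed
  have half: "1 / (real n + 2) \<le> 1 / 2" for n by (simp add: field_simps)
  have zero: "h n x = 0" if "\<bar>x\<bar> < real n" for n x
    using near[of n x] half[of n] that by linarith
  have cont: "continuous_on UNIV (h n)" for n
  proof -
    have "continuous_on UNIV (g (Suc n) \<circ> (\<lambda>x. x + real (Suc n)))"
      by (intro continuous_on_compose continuous_intros
          continuous_on_subset[OF Cc_continuous[OF assms(1)]]) auto
    then show ?thesis by (simp add: h_def o_def)
  qed
  have bnd: "\<bar>x\<bar> \<le> real n + 2" if "h n x \<noteq> 0" for n x
    using near[OF that] half[of n] by linarith
  have hCc: "h n \<in> Cc" for n
    unfolding Cc_iff using cont bnd by (meson not_le)
  have hG: "G x = h n x" if "h n x \<noteq> 0" for n x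
  proof -
    have "h m x = 0" if "m \<noteq> n" for m
    proof (rule ccontr)
      assume m: "h m x \<noteq> 0"
      \<comment> \<open>at most one of the two half-widths is 1/2, the other is at most 1/3, while the centres
        are at least 1 apart\<close>
      have third: "1 / (real k + 2) \<le> 1 / 3" if "1 \<le> k" for k
        using that by (simp add: field_simps)
      have "1 / (real m + 2) + 1 / (real n + 2) < 1"
      proof (cases "1 \<le> m")
        case True
        then show ?thesis using third[of m] half[of n] by linarith
      next
        case False
        then have "1 \<le> n" using \<open>m \<noteq> n\<close> by simp
        then show ?thesis using third[of n] half[of m] by linarith
      qed
      then have "\<bar>real m - real n\<bar> < 1"
        using near[OF m] near[OF \<open>h n x \<noteq> 0\<close>] by auto
      then show False using \<open>m \<noteq> n\<close> by linarith
    qed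
    then have "(\<Sum>m. h m x) = (\<Sum>m\<in>{n}. h m x)" by (intro suminf_finite) auto
    then show ?thesis by (simp add: G_def)
  qed
  have G: "continuous_on UNIV G"
    unfolding G_def[abs_def] by (rule continuous_on_locally_finite_suminf[OF cont zero])
  have sums: "(\<lambda>n. LBINT x. \<phi> x * h n x) sums (LBINT x. \<phi> x * G x)" if "\<phi> \<in> Cc" for \<phi>
    unfolding G_def by (rule integral_locally_finite_suminf[OF cont zero that])
  have \<mu>: "\<mu> \<phi> = (LBINT x. \<phi> x * G x)" if "\<phi> \<in> Cc" for \<phi>
    unfolding \<mu>_def by (rule sums_unique[OF sums[OF that], symmetric])
  have F: "cmod (fourier (h n) t) \<le> (1 / 2) ^ Suc n" for n t
  proof -
    have "cmod (fourier (h n) t) = cmod (fourier (g (Suc n)) t)"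
      unfolding h_def[abs_def] by (rule cmod_fourier_shift)
    also have "\<dots> \<le> sup_norm (fourier (g (Suc n)))"
      unfolding sup_norm_def by (intro cSUP_upper bdd_aboveI2[OF cmod_fourier_le]) simp
    also have "\<dots> \<le> (1 / 2) ^ Suc n" by (rule assms(4)) simp
    finally show ?thesis .
  qed
  have radon: "radon_measure \<mu>" by (rule radon_measure_density[OF G \<mu>])
  show ?thesis
  proof (intro exI[of _ \<mu>] conjI impI)
    show "converges_vaguely (\<lambda>n \<phi>. \<Sum>j=1..n. (LBINT x. \<phi> x * g j (x + real j))) \<mu>"
      unfolding converges_vaguely_def
    proof
      fix \<phi> :: "real \<Rightarrow> complex" assume \<phi>: "\<phi> \<in> Cc"
      have "(\<lambda>n. \<Sum>k<n. LBINT x. \<phi> x * h k x) \<longlonglongrightarrow> \<mu> \<phi>"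
        using sums[OF \<phi>] by (simp add: sums_def \<mu>[OF \<phi>])
      then show "(\<lambda>n. \<Sum>j=1..n. LBINT x. \<phi> x * g j (x + real j)) \<longlonglongrightarrow> \<mu> \<phi>"
        by (simp add: h_def sum.atLeast1_atMost_eq)
    qed
    show "radon_measure \<mu>" by (rule radon)
    show "signed_radon_measure \<mu>" if real: "\<forall>n\<ge>1. \<forall>x. g n x \<in> \<real>"
      unfolding signed_radon_measure_def
    proof (intro conjI ballI impI radon)
      fix \<phi> :: "real \<Rightarrow> complex" assume \<phi>: "\<phi> \<in> Cc" and "\<forall>x. \<phi> x \<in> \<real>"
      moreover have "h n x \<in> \<real>" for n x using real by (simp add: h_def)
      ultimately have re: "\<phi> x * h n x = complex_of_real (Re (\<phi> x * h n x))" for n x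
        by (metis Reals_mult of_real_Re)
      have "(LBINT x. \<phi> x * h n x) = complex_of_real (LBINT x. Re (\<phi> x * h n x))" for n
        by (subst re) (rule integral_complex_of_real)
      then have "Im (LBINT x. \<phi> x * h n x) = 0" for n by simp
      then have "(\<lambda>n. 0) sums Im (LBINT x. \<phi> x * G x)"
        using sums_Im[OF sums[OF \<phi>]] by simp
      then have "Im (\<mu> \<phi>) = 0"
        unfolding \<mu>[OF \<phi>] using sums_unique2 sums_zero by blast
      then show "\<mu> \<phi> \<in> \<real>" by (simp add: complex_is_Real_iff)
    qed
    show "tempered \<mu>"
      unfolding tempered_def \<mu>_def
      by (rule exI, rule conjI, rule tempered_distribution_series[OF hCc _ F])
         (auto intro!: summable_geometric)
    show "\<not> slowly_increasing \<mu>"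
    proof (rule not_slowly_increasing_density[OF G \<mu> hCc])
      show "G x = h n x \<and> \<bar>x\<bar> \<le> real n + 2" if "h n x \<noteq> 0" for n x
        using hG[OF that] bnd[OF that] by simp
      have "L1_norm (h n) = L1_norm (g (Suc n))" for n
        unfolding L1_norm_def h_def
        using lborel_integral_real_affine[of 1 "\<lambda>x. cmod (g (Suc n) x)" "real (Suc n)"]
        by (simp add: add.commute)
      then show "((real (Suc n))\<^sup>2 + 1) ^ Suc n \<le> L1_norm (h n)" for n
        using assms(3)[of "Suc n"] by simp
    qed
  qed
qed

end
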